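(* Given the rook graph $K_n\square K_m$, one has $\operatorname{gon}_2(K_n\square K_m)=nm-1$ and $\operatorname{gon}_3(K_n\square K_m)=nm$.
   Context: For a positive integer $n$, $K_n$ is the complete graph on $n$ vertices. $G\square H$ is the Cartesian product of graphs: vertices are pairs $(x,y)$ with $x\in V(G)$, $y\in V(H)$; $(x,y_1)\sim(x,y_2)$ when $y_1\sim y_2$ in $H$, and $(x_1,y)\sim(x_2,y)$ when $x_1\sim x_2$ in $G$. A rook graph is the Cartesian product of two or more complete graphs. Let $G$ be a finite connected loopless graph (multiple edges allowed). A divisor on $G$ is an integer vector $D\in\mathbb{Z}^{V(G)}$ (the coordinate $D(v)$ is thought of as the number of chips on $v$); its degree is $\deg(D)=\sum_v D(v)$; it is effective if $D(v)\ge 0$ for all $v$. Firing a vertex $v$ transforms a divisor by moving one chip from $v$ along each edge incident to $v$ to the other endpoint of that edge. Two divisors are equivalent if one can be obtained from the other by a finite sequence of vertex firings. For an integer $r\ge 0$, a divisor $D$ has rank at least $r$ if for every effective divisor $E$ of degree $r$, the divisor $D-E$ is equivalent to an effective divisor. The $k$-gonality $\operatorname{gon}_k(G)$ is the minimum degree of a divisor on $G$ of rank at least $k$.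
   Formalization: The formal theorem assumes n ≥ 2 and m ≥ 2; with a factor K_1 the product is a complete graph and the formulas fail (e.g. K_1□K_2 = K_2 has 2-gonality 2, not nm−1 = 1). *)

theory Defs
  imports Main
begin

section \<open>Finite connected loopless multigraphs\<close>

text \<open>
  A multigraph is given by its vertex set and, for each pair of vertices, the number of
  edges joining them.
\<close>

record 'v multigraph =
  verts :: "'v set"
  edge_mult :: "'v \<Rightarrow> 'v \<Rightarrow> nat"

definition adjacent :: "'v multigraph \<Rightarrow> 'v \<Rightarrow> 'v \<Rightarrow> bool" where
  "adjacent G u v \<longleftrightarrow> edge_mult G u v > 0"

definition valency :: "'v multigraph \<Rightarrow> 'v \<Rightarrow> nat" where
  "valency G v = (\<Sum>w\<in>verts G. edge_mult G v w)"

locale connected_multigraph =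
  fixes G :: "'v multigraph"
  assumes finite_verts: "finite (verts G)"
    and verts_nonempty: "verts G \<noteq> {}"
    and edge_mult_sym: "edge_mult G u v = edge_mult G v u"
    and edge_mult_verts: "edge_mult G u v > 0 \<Longrightarrow> u \<in> verts G \<and> v \<in> verts G"
    and loopless: "edge_mult G v v = 0"
    and connected: "u \<in> verts G \<Longrightarrow> v \<in> verts G \<Longrightarrow> (adjacent G)\<^sup>*\<^sup>* u v"

definition complete_graph :: "nat \<Rightarrow> nat multigraph" where
  "complete_graph n =
     \<lparr> verts = {..<n},
       edge_mult = (\<lambda>u v. if u < n \<and> v < n \<and> u \<noteq> v then 1 else 0) \<rparr>"

definition cartesian_product ::
    "'a multigraph \<Rightarrow> 'b multigraph \<Rightarrow> ('a \<times> 'b) multigraph" (infixl "\<box>" 70) where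
  "G \<box> H =
     \<lparr> verts = verts G \<times> verts H,
       edge_mult = (\<lambda>(x1, y1) (x2, y2).
         (if x1 = x2 \<and> x1 \<in> verts G then edge_mult H y1 y2 else 0) +
         (if y1 = y2 \<and> y1 \<in> verts H then edge_mult G x1 x2 else 0)) \<rparr>"


section \<open>Chip firing and gonality\<close>

text \<open>
  Divisors are total functions that vanish off the vertex set, so that equality of
  divisors is equality of functions.
\<close>

definition divisors :: "'v multigraph \<Rightarrow> ('v \<Rightarrow> int) set" where
  "divisors G = {D. \<forall>v. v \<notin> verts G \<longrightarrow> D v = 0}"

definition deg :: "'v multigraph \<Rightarrow> ('v \<Rightarrow> int) \<Rightarrow> int" where
  "deg G D = (\<Sum>v\<in>verts G. D v)"

definition effective :: "'v multigraph \<Rightarrow> ('v \<Rightarrow> int) \<Rightarrow> bool" where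
  "effective G D \<longleftrightarrow> D \<in> divisors G \<and> (\<forall>v\<in>verts G. D v \<ge> 0)"

definition fire :: "'v multigraph \<Rightarrow> 'v \<Rightarrow> ('v \<Rightarrow> int) \<Rightarrow> ('v \<Rightarrow> int)" where
  "fire G v D =
     (\<lambda>w. D w + int (edge_mult G v w) - (if w = v then int (valency G v) else 0))"

definition fires_to :: "'v multigraph \<Rightarrow> ('v \<Rightarrow> int) \<Rightarrow> ('v \<Rightarrow> int) \<Rightarrow> bool" where
  "fires_to G D D' \<longleftrightarrow> (\<exists>v\<in>verts G. D' = fire G v D)"

text \<open>
  This relation is symmetric on finite loopless multigraphs, see
  \<open>equivalent_sym\<close> below: firing every vertex other than \<open>v\<close> undoes firing \<open>v\<close>.
\<close>

definition equivalent :: "'v multigraph \<Rightarrow> ('v \<Rightarrow> int) \<Rightarrow> ('v \<Rightarrow> int) \<Rightarrow> bool" where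
  "equivalent G = (fires_to G)\<^sup>*\<^sup>*"

definition rank_at_least :: "'v multigraph \<Rightarrow> nat \<Rightarrow> ('v \<Rightarrow> int) \<Rightarrow> bool" where
  "rank_at_least G r D \<longleftrightarrow>
     (\<forall>E. effective G E \<and> deg G E = int r \<longrightarrow>
        (\<exists>D'. effective G D' \<and> equivalent G (\<lambda>v. D v - E v) D'))"

definition gon :: "nat \<Rightarrow> 'v multigraph \<Rightarrow> int" where
  "gon k G = (LEAST d. \<exists>D\<in>divisors G. deg G D = d \<and> rank_at_least G k D)"


section \<open>Basic properties\<close>

lemma connected_multigraph_complete_graph:
  assumes "n \<ge> 1"
  shows "connected_multigraph (complete_graph n)"
proof
  fix u v
  assume uv: "u \<in> verts (complete_graph n)" "v \<in> verts (complete_graph n)"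
  show "(adjacent (complete_graph n))\<^sup>*\<^sup>* u v"
  proof (cases "u = v")
    case False
    with uv have "adjacent (complete_graph n) u v"
      by (auto simp: adjacent_def complete_graph_def)
    then show ?thesis by blast
  qed simp
qed (use assms in \<open>auto simp: complete_graph_def lessThan_empty_iff split: if_splits\<close>)

lemma connected_multigraph_cartesian_product:
  assumes "connected_multigraph G" "connected_multigraph H"
  shows "connected_multigraph (G \<box> H)"
proof -
  interpret G: connected_multigraph G by fact
  interpret H: connected_multigraph H by fact
  have lift1: "(adjacent (G \<box> H))\<^sup>*\<^sup>* (a, y) (b, y)"
    if "(adjacent G)\<^sup>*\<^sup>* a b" "y \<in> verts H" for a b y
    using that(1)
  proof induction
    case (step b c)
    then have "adjacent (G \<box> H) (b, y) (c, y)"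
      using that(2) by (simp add: adjacent_def cartesian_product_def)
    with step.IH show ?case by (rule rtranclp.rtrancl_into_rtrancl)
  qed simp
  have lift2: "(adjacent (G \<box> H))\<^sup>*\<^sup>* (x, a) (x, b)"
    if "(adjacent H)\<^sup>*\<^sup>* a b" "x \<in> verts G" for a b x
    using that(1)
  proof induction
    case (step b c)
    then have "adjacent (G \<box> H) (x, b) (x, c)"
      using that(2) by (simp add: adjacent_def cartesian_product_def)
    with step.IH show ?case by (rule rtranclp.rtrancl_into_rtrancl)
  qed simp
  show ?thesis
  proof
    show "finite (verts (G \<box> H))"
      by (simp add: cartesian_product_def G.finite_verts H.finite_verts)
    show "verts (G \<box> H) \<noteq> {}"
      by (simp add: cartesian_product_def G.verts_nonempty H.verts_nonempty)
    show "edge_mult (G \<box> H) u v = edge_mult (G \<box> H) v u" for u v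
      using G.edge_mult_sym[of "fst u" "fst v"] H.edge_mult_sym[of "snd u" "snd v"]
      by (auto simp: cartesian_product_def split_beta)
    show "u \<in> verts (G \<box> H) \<and> v \<in> verts (G \<box> H)" if "edge_mult (G \<box> H) u v > 0" for u v
      using that G.edge_mult_verts H.edge_mult_verts
      by (cases u; cases v) (auto simp: cartesian_product_def split: if_splits)
    show "edge_mult (G \<box> H) v v = 0" for v
      by (cases v) (simp add: cartesian_product_def G.loopless H.loopless)
    show "(adjacent (G \<box> H))\<^sup>*\<^sup>* u v"
      if u: "u \<in> verts (G \<box> H)" and v: "v \<in> verts (G \<box> H)" for u v
    proof -
      obtain a b c d where uv: "u = (a, b)" "v = (c, d)" by (cases u; cases v)
      have in_verts: "a \<in> verts G" "b \<in> verts H" "c \<in> verts G" "d \<in> verts H"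
        using u v by (auto simp: uv cartesian_product_def)
      have "(adjacent (G \<box> H))\<^sup>*\<^sup>* (a, b) (c, b)"
        by (intro lift1 G.connected in_verts)
      also have "(adjacent (G \<box> H))\<^sup>*\<^sup>* (c, b) (c, d)"
        by (intro lift2 H.connected in_verts)
      finally show ?thesis by (simp add: uv)
    qed
  qed
qed

lemma equivalent_fire_set:
  assumes "finite S" "S \<subseteq> verts G"
  shows "equivalent G D
           (\<lambda>w. D w + (\<Sum>v\<in>S. int (edge_mult G v w)) -
                (if w \<in> S then int (valency G w) else 0))"
  using assms
proof (induction S)
  case empty
  show ?case by (simp add: equivalent_def)
next
  case (insert x S)
  let ?F = "\<lambda>S w. D w + (\<Sum>v\<in>S. int (edge_mult G v w)) -
                (if w \<in> S then int (valency G w) else 0)"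
  have "?F (insert x S) = fire G x (?F S)"
    using insert.hyps by (auto simp: fire_def fun_eq_iff)
  then have "fires_to G (?F S) (?F (insert x S))"
    using insert.prems by (auto simp: fires_to_def)
  moreover have "equivalent G D (?F S)"
    using insert by simp
  ultimately show ?case
    unfolding equivalent_def by (rule rtranclp.rtrancl_into_rtrancl[rotated])
qed

context connected_multigraph
begin

lemma fire_divisors:
  assumes "v \<in> verts G" "D \<in> divisors G"
  shows "fire G v D \<in> divisors G"
  using assms edge_mult_verts by (fastforce simp: divisors_def fire_def)

lemma deg_fire:
  assumes "v \<in> verts G"
  shows "deg G (fire G v D) = deg G D"
  using assms finite_verts
  by (simp add: deg_def fire_def sum.distrib sum_subtractf valency_def)

lemma equivalent_unfire:
  assumes v: "v \<in> verts G"
  shows "equivalent G (fire G v D) D"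
proof -
  let ?S = "verts G - {v}"
  let ?D = "\<lambda>w. fire G v D w + (\<Sum>u\<in>?S. int (edge_mult G u w)) -
                (if w \<in> ?S then int (valency G w) else 0)"
  have total: "int (edge_mult G v w) + (\<Sum>u\<in>?S. int (edge_mult G u w)) = int (valency G w)" for w
  proof -
    have "int (valency G w) = (\<Sum>u\<in>verts G. int (edge_mult G u w))"
      by (simp add: valency_def edge_mult_sym[of w])
    then show ?thesis using v finite_verts by (simp add: sum.remove)
  qed
  have "valency G w = 0" if "w \<notin> verts G" for w
    unfolding valency_def using that edge_mult_verts[of w] by (intro sum.neutral) blast
  then have "?D w = D w" for w
    using total[of w] v by (auto simp: fire_def)
  then have "?D = D" by auto
  then show ?thesis
    using equivalent_fire_set[of ?S G "fire G v D"] finite_verts by simp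
qed

lemma equivalent_sym:
  assumes "equivalent G D D'"
  shows "equivalent G D' D"
  using assms unfolding equivalent_def
proof induction
  case (step D' D'')
  then obtain v where "v \<in> verts G" "D'' = fire G v D'" by (auto simp: fires_to_def)
  then have "(fires_to G)\<^sup>*\<^sup>* D'' D'"
    using equivalent_unfire by (simp add: equivalent_def)
  with step.IH show ?case by (rule rtranclp_trans[rotated])
qed simp

end

end

theory Submission
  imports Defs
begin

text \<open>
  Upper bounds: the divisor with one chip everywhere has rank \<open>3\<close>, since any debt left after
  removing three chips is repaid by firing the complement of a row, of a column or of a vertex;
  removing one chip lowers the rank by at most one. For the same reason the lower bound for
  \<open>gon 3\<close> follows from the one for \<open>gon 2\<close>.

  Lower bound: suppose \<open>D\<close> is effective of rank \<open>2\<close> and degree at most \<open>n * m - 2\<close>, chosen in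
  its class with minimal energy. Minimality forces every set \<open>A\<close> that can legally be fired to have
  an edge boundary smaller than \<open>2 * card A\<close>, which fails unless \<open>A\<close> contains a full row or
  column. Take a row with fewer than \<open>m\<close> chips. Remove a chip from an empty vertex of that row and
  one from an occupied vertex of it, if there is any: a set that is still legal avoids the row,
  and must then consist of all other rows, so that every vertex outside the row carries a chip.
  The same holds for a column with fewer than \<open>n\<close> chips, so at most one vertex is without a chip, and the degree is at least
  \<open>n * m - 1\<close>.
\<close>

section \<open>Laplacians and legal firing sets\<close>

text \<open>Subtracting \<open>laplacian G f\<close> from a divisor fires each vertex
  \<open>v\<close> exactly \<open>f v\<close> times, a negative count meaning borrowing.\<close>

definition laplacian :: "'v multigraph \<Rightarrow> ('v \<Rightarrow> int) \<Rightarrow> 'v \<Rightarrow> int" where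
  "laplacian G f v = (\<Sum>w\<in>verts G. int (edge_mult G v w) * (f v - f w))"

lemma laplacian_add: "laplacian G (\<lambda>v. f v + g v) v = laplacian G f v + laplacian G g v"
  unfolding laplacian_def sum.distrib[symmetric] by (simp add: algebra_simps)

context connected_multigraph
begin

lemma edge_mult_eq_0: "v \<notin> verts G \<Longrightarrow> edge_mult G v w = 0"
  using edge_mult_verts[of v w] by blast

lemma laplacian_eq_0: "v \<notin> verts G \<Longrightarrow> laplacian G f v = 0"
  by (simp add: laplacian_def edge_mult_eq_0)

lemma laplacian_indicator:
  assumes "S \<subseteq> verts G"
  shows "laplacian G (\<lambda>w. of_bool (w \<in> S)) v =
           (if v \<in> S then int (valency G v) else 0) - (\<Sum>w\<in>S. int (edge_mult G w v))"
proof -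
  have "laplacian G (\<lambda>w. of_bool (w \<in> S)) v =
          (\<Sum>w\<in>verts G. int (edge_mult G v w) * of_bool (v \<in> S))
          - (\<Sum>w\<in>verts G. int (edge_mult G v w) * of_bool (w \<in> S))"
    unfolding laplacian_def sum_subtractf[symmetric] by (simp add: right_diff_distrib)
  also have "(\<Sum>w\<in>verts G. int (edge_mult G v w) * of_bool (w \<in> S))
             = (\<Sum>w\<in>S. int (edge_mult G w v))"
    using assms finite_verts
    by (intro sum.mono_neutral_cong_right) (auto simp: edge_mult_sym)
  finally show ?thesis by (simp add: valency_def)
qed

lemma equivalent_fire_indicator:
  assumes "S \<subseteq> verts G"
  shows "equivalent G D (\<lambda>v. D v - laplacian G (\<lambda>w. of_bool (w \<in> S)) v)"
  using equivalent_fire_set[of S G D] assms finite_verts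
  by (simp add: laplacian_indicator finite_subset algebra_simps)

text \<open>Firing \<open>S\<close> in the divisor on the right gives back \<open>D\<close>, and
  equivalence is symmetric.\<close>

lemma equivalent_unfire_indicator:
  assumes "S \<subseteq> verts G"
  shows "equivalent G D (\<lambda>v. D v + laplacian G (\<lambda>w. of_bool (w \<in> S)) v)"
  using equivalent_fire_indicator[OF assms,
      of "\<lambda>v. D v + laplacian G (\<lambda>w. of_bool (w \<in> S)) v"]
  by (simp add: equivalent_sym)

text \<open>Each single firing adds the indicator of a vertex to the script \<open>f\<close>, so
  scripts accumulate along the chain of firings.\<close>

lemma equivalent_imp_laplacian:
  assumes "equivalent G D D'"
  shows "\<exists>f. D' = (\<lambda>v. D v - laplacian G f v)"
  using assms unfolding equivalent_def
proof induction
  case base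
  then show ?case by (intro exI[of _ "\<lambda>_. 0"]) (simp add: laplacian_def)
next
  case (step D' D'')
  then obtain f x where f: "D' = (\<lambda>v. D v - laplacian G f v)" and x: "x \<in> verts G"
    and D'': "D'' = fire G x D'"
    by (auto simp: fires_to_def)
  have "D'' = (\<lambda>v. D' v - laplacian G (\<lambda>w. of_bool (w \<in> {x})) v)"
    unfolding D'' fire_def using x by (subst laplacian_indicator) auto
  then have "D'' = (\<lambda>v. D v - laplacian G (\<lambda>w. f w + of_bool (w \<in> {x})) v)"
    by (simp add: f laplacian_add algebra_simps)
  then show ?case by blast
qed

text \<open>The set on which a firing script is maximal can be fired first.\<close>

lemma legal_set_exists:
  assumes eq: "equivalent G F D'" and eff: "effective G D'"
  shows "\<exists>A\<subseteq>verts G. A \<noteq> {} \<and> (\<forall>v\<in>A. laplacian G (\<lambda>w. of_bool (w \<in> A)) v \<le> F v)"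
proof -
  obtain f where f: "D' = (\<lambda>v. F v - laplacian G f v)"
    using equivalent_imp_laplacian[OF eq] by blast
  define A where "A = {v \<in> verts G. f v = Max (f ` verts G)}"
  have "Max (f ` verts G) \<in> f ` verts G"
    using finite_verts verts_nonempty by (intro Max_in) auto
  then have "A \<noteq> {}" by (auto simp: A_def)
  moreover have "laplacian G (\<lambda>w. of_bool (w \<in> A)) v \<le> F v" if v: "v \<in> A" for v
  proof -
    \<comment> \<open>A vertex of \<open>A\<close> maximizes \<open>f\<close>, and by integrality
      \<open>f\<close> drops by at least 1 towards every vertex outside \<open>A\<close>.\<close>
    have "laplacian G (\<lambda>w. of_bool (w \<in> A)) v \<le> laplacian G f v"
      unfolding laplacian_def
    proof (intro sum_mono mult_left_mono)
      fix w assume w: "w \<in> verts G"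
      then have "f w \<le> Max (f ` verts G)" using finite_verts by simp
      then show "of_bool (v \<in> A) - of_bool (w \<in> A) \<le> f v - f w"
        using v w by (auto simp: A_def)
    qed simp
    also have "\<dots> \<le> F v"
      using eff v by (auto simp: effective_def f A_def)
    finally show ?thesis .
  qed
  ultimately show ?thesis by (intro exI[of _ A]) (auto simp: A_def)
qed

section \<open>Degree and rank within an equivalence class\<close>

lemma equivalent_deg: "equivalent G D D' \<Longrightarrow> deg G D' = deg G D"
  unfolding equivalent_def
  by (induction rule: rtranclp_induct) (auto simp: fires_to_def deg_fire)

lemma equivalent_diff:
  assumes "equivalent G D D'"
  shows "equivalent G (\<lambda>v. D v - E v) (\<lambda>v. D' v - E v)"
  using assms unfolding equivalent_def
proof induction
  case (step D' D'')
  then have "fires_to G (\<lambda>v. D' v - E v) (\<lambda>v. D'' v - E v)"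
    by (auto simp: fires_to_def fire_def algebra_simps)
  with step.IH show ?case by simp
qed simp

lemma rank_at_least_equivalent:
  assumes "equivalent G D D'" "rank_at_least G k D"
  shows "rank_at_least G k D'"
  unfolding rank_at_least_def
proof (intro allI impI)
  fix E assume "effective G E \<and> deg G E = int k"
  then obtain D1 where D1: "effective G D1" "equivalent G (\<lambda>v. D v - E v) D1"
    using assms(2) unfolding rank_at_least_def by blast
  have "equivalent G (\<lambda>v. D' v - E v) (\<lambda>v. D v - E v)"
    using equivalent_diff equivalent_sym assms(1) by blast
  then show "\<exists>D1. effective G D1 \<and> equivalent G (\<lambda>v. D' v - E v) D1"
    using D1 unfolding equivalent_def by (meson rtranclp_trans)
qed

lemma deg_of_bool: "v \<in> verts G \<Longrightarrow> deg G (\<lambda>w. of_bool (w = v)) = 1"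
  using finite_verts by (simp add: deg_def of_bool_def sum.delta)

lemma deg_add: "deg G (\<lambda>v. D v + E v) = deg G D + deg G E"
  by (simp add: deg_def sum.distrib)

lemma deg_diff: "deg G (\<lambda>v. D v - E v) = deg G D - deg G E"
  by (simp add: deg_def sum_subtractf)

text \<open>The removed chip is added to \<open>E\<close>, which then has degree
  \<open>Suc k\<close>.\<close>

lemma rank_at_least_remove_chip:
  assumes "rank_at_least G (Suc k) D" "v \<in> verts G"
  shows "rank_at_least G k (\<lambda>w. D w - of_bool (w = v))"
  unfolding rank_at_least_def
proof (intro allI impI)
  fix E assume E: "effective G E \<and> deg G E = int k"
  let ?E = "\<lambda>w. E w + of_bool (w = v)"
  have "effective G ?E"
    using E assms(2) by (auto simp: effective_def divisors_def)
  moreover have "deg G ?E = int (Suc k)"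
    using E assms(2) by (simp add: deg_add deg_of_bool)
  ultimately obtain D1 where "effective G D1" "equivalent G (\<lambda>w. D w - ?E w) D1"
    using assms(1) unfolding rank_at_least_def by blast
  then show "\<exists>D1. effective G D1 \<and> equivalent G (\<lambda>w. D w - of_bool (w = v) - E w) D1"
    by (auto simp: algebra_simps)
qed

text \<open>Take \<open>k\<close> chips from one vertex, pass to an effective divisor, and put the
  chips back.\<close>

lemma rank_at_least_imp_effective:
  assumes "rank_at_least G k D"
  shows "\<exists>D'. effective G D' \<and> equivalent G D D'"
proof -
  obtain v where v: "v \<in> verts G" using verts_nonempty by blast
  let ?E = "\<lambda>w. int k * of_bool (w = v)"
  have "effective G ?E" using v by (auto simp: effective_def divisors_def)
  moreover have "deg G ?E = int k"
    using deg_of_bool[OF v] by (simp add: deg_def sum_distrib_left[symmetric])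
  ultimately obtain D1 where D1: "effective G D1" "equivalent G (\<lambda>w. D w - ?E w) D1"
    using assms unfolding rank_at_least_def by blast
  have "equivalent G D (\<lambda>w. D1 w + ?E w)"
    using equivalent_diff[OF D1(2), of "\<lambda>w. - ?E w"] by simp
  moreover have "effective G (\<lambda>w. D1 w + ?E w)"
    using D1(1) v by (auto simp: effective_def divisors_def)
  ultimately show ?thesis by blast
qed

end

section \<open>The Laplacian of the rook graph and its energy\<close>

text \<open>Valencies are \<open>n + m - 2\<close>; the coefficient is \<open>n + m\<close> because
  \<open>a i j\<close> itself occurs in both the row sum and the column sum.\<close>

definition rook_laplacian :: "nat \<Rightarrow> nat \<Rightarrow> (nat \<Rightarrow> nat \<Rightarrow> int) \<Rightarrow> nat \<Rightarrow> nat \<Rightarrow> int" where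
  "rook_laplacian n m a i j =
     int (n + m) * a i j - (\<Sum>j'<m. a i j') - (\<Sum>i'<n. a i' j)"

lemma rook_laplacian_transpose:
  "rook_laplacian m n (\<lambda>j i. a i j) j i = rook_laplacian n m a i j"
  by (simp add: rook_laplacian_def algebra_simps)

abbreviation rook :: "nat \<Rightarrow> nat \<Rightarrow> (nat \<times> nat) multigraph" where
  "rook n m \<equiv> complete_graph n \<box> complete_graph m"

lemma verts_rook: "verts (rook n m) = {..<n} \<times> {..<m}"
  by (simp add: cartesian_product_def complete_graph_def)

lemma edge_mult_rook:
  assumes "i < n" "j < m" "i' < n" "j' < m"
  shows "edge_mult (rook n m) (i, j) (i', j') =
           of_bool (i = i' \<and> j \<noteq> j') + of_bool (j = j' \<and> i \<noteq> i')"
  using assms by (auto simp: cartesian_product_def complete_graph_def)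

lemma laplacian_rook:
  assumes "i < n" "j < m"
  shows "laplacian (rook n m) f (i, j) = rook_laplacian n m (curry f) i j"
proof -
  have "laplacian (rook n m) f (i, j) =
          (\<Sum>i'<n. \<Sum>j'<m. int (edge_mult (rook n m) (i, j) (i', j')) * (f (i, j) - f (i', j')))"
    by (simp add: laplacian_def verts_rook sum.cartesian_product)
  also have "\<dots> = (\<Sum>i'<n. \<Sum>j'<m. (if i' = i then f (i, j) - f (i, j') else 0)
                      + (if j' = j then f (i, j) - f (i', j) else 0))"
    using assms by (intro sum.cong) (auto simp: edge_mult_rook)
  also have "\<dots> = (\<Sum>i'<n. \<Sum>j'<m. if i' = i then f (i, j) - f (i, j') else 0)
                + (\<Sum>i'<n. \<Sum>j'<m. if j' = j then f (i, j) - f (i', j) else 0)"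
    by (simp add: sum.distrib)
  also have "(\<Sum>i'<n. \<Sum>j'<m. if i' = i then f (i, j) - f (i, j') else 0)
               = (\<Sum>j'<m. f (i, j) - f (i, j'))"
    by (subst sum.swap) (use assms in \<open>simp add: sum.delta\<close>)
  also have "(\<Sum>i'<n. \<Sum>j'<m. if j' = j then f (i, j) - f (i', j) else 0)
               = (\<Sum>i'<n. f (i, j) - f (i', j))"
    using assms by (simp add: sum.delta)
  finally show ?thesis
    by (simp add: rook_laplacian_def sum_subtractf algebra_simps)
qed

lemma connected_multigraph_rook:
  "n \<ge> 1 \<Longrightarrow> m \<ge> 1 \<Longrightarrow> connected_multigraph (rook n m)"
  by (intro connected_multigraph_cartesian_product connected_multigraph_complete_graph)

text \<open>
  On divisors of degree \<open>0\<close>, up to the factor \<open>n * m * (n + m)\<close>, this is the bilinear form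
  of the pseudo-inverse of the Laplacian.
\<close>

definition energy ::
    "nat \<Rightarrow> nat \<Rightarrow> (nat \<Rightarrow> nat \<Rightarrow> int) \<Rightarrow> (nat \<Rightarrow> nat \<Rightarrow> int) \<Rightarrow> int" where
  "energy n m D F =
     int (n * m) * (\<Sum>i<n. \<Sum>j<m. D i j * F i j)
     + int m * (\<Sum>i<n. (\<Sum>j<m. D i j) * (\<Sum>j<m. F i j))
     + int n * (\<Sum>j<m. (\<Sum>i<n. D i j) * (\<Sum>i<n. F i j))"

lemma energy_nonneg: "energy n m D D \<ge> 0"
  unfolding energy_def
  by (intro add_nonneg_nonneg mult_nonneg_nonneg[OF of_nat_0_le_iff] sum_nonneg zero_le_square)

lemma energy_commute: "energy n m D F = energy n m F D"
  by (simp add: energy_def mult.commute)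

lemma energy_diff_right:
  "energy n m D (\<lambda>i j. F i j - F' i j) = energy n m D F - energy n m D F'"
  by (simp add: energy_def sum_subtractf algebra_simps)

lemma energy_diff_left:
  "energy n m (\<lambda>i j. F i j - F' i j) D = energy n m F D - energy n m F' D"
  by (simp add: energy_def sum_subtractf algebra_simps)

lemma sum_rook_laplacian_row:
  "(\<Sum>j<m. rook_laplacian n m a i j) = int n * (\<Sum>j<m. a i j) - (\<Sum>i<n. \<Sum>j<m. a i j)"
proof -
  have "(\<Sum>j<m. \<Sum>i<n. a i j) = (\<Sum>i<n. \<Sum>j<m. a i j)" by (rule sum.swap)
  then show ?thesis
    by (simp add: rook_laplacian_def sum_subtractf sum_distrib_left[symmetric] distrib_right sum.distrib)
qed

lemma sum_rook_laplacian_column: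
  "(\<Sum>i<n. rook_laplacian n m a i j) = int m * (\<Sum>i<n. a i j) - (\<Sum>i<n. \<Sum>j<m. a i j)"
  by (simp add: rook_laplacian_def sum_subtractf sum_distrib_left[symmetric] distrib_right sum.distrib)

lemma sum_mult_rook_laplacian:
  "(\<Sum>i<n. \<Sum>j<m. D i j * rook_laplacian n m a i j) =
     int (n + m) * (\<Sum>i<n. \<Sum>j<m. D i j * a i j)
     - (\<Sum>i<n. (\<Sum>j<m. D i j) * (\<Sum>j<m. a i j))
     - (\<Sum>j<m. (\<Sum>i<n. D i j) * (\<Sum>i<n. a i j))"
proof -
  have "(\<Sum>i<n. \<Sum>j<m. D i j * (\<Sum>i'<n. a i' j)) = (\<Sum>j<m. (\<Sum>i<n. D i j) * (\<Sum>i<n. a i j))"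
    by (subst sum.swap) (simp add: sum_distrib_right)
  moreover have "(\<Sum>i<n. \<Sum>j<m. D i j * (\<Sum>j'<m. a i j')) = (\<Sum>i<n. (\<Sum>j<m. D i j) * (\<Sum>j<m. a i j))"
    by (simp add: sum_distrib_right)
  moreover have "D i j * rook_laplacian n m a i j = int (n + m) * (D i j * a i j)
      - D i j * (\<Sum>j'<m. a i j') - D i j * (\<Sum>i'<n. a i' j)" for i j
    by (simp add: rook_laplacian_def algebra_simps)
  ultimately show ?thesis
    by (simp add: sum_subtractf sum_distrib_left[symmetric])
qed

text \<open>The products of row sums and of column sums cancel between the three terms of
  \<open>energy\<close>. What survives is the scalar product of \<open>D\<close> and
  \<open>a\<close>, corrected by the product of their totals.\<close>

lemma energy_rook_laplacian:
  "energy n m D (rook_laplacian n m a) =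
     int (n + m) * (int (n * m) * (\<Sum>i<n. \<Sum>j<m. D i j * a i j)
       - (\<Sum>i<n. \<Sum>j<m. D i j) * (\<Sum>i<n. \<Sum>j<m. a i j))"
proof -
  let ?R = "\<lambda>i. \<Sum>j<m. D i j" and ?r = "\<lambda>i. \<Sum>j<m. a i j"
    and ?C = "\<lambda>j. \<Sum>i<n. D i j" and ?c = "\<lambda>j. \<Sum>i<n. a i j"
  let ?d = "\<Sum>i<n. ?R i" and ?s = "\<Sum>i<n. ?r i"
  have row: "(\<Sum>i<n. ?R i * (\<Sum>j<m. rook_laplacian n m a i j)) = int n * (\<Sum>i<n. ?R i * ?r i) - ?d * ?s"
  proof -
    have "?R i * (\<Sum>j<m. rook_laplacian n m a i j) = int n * (?R i * ?r i) - ?R i * ?s" for i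
      unfolding sum_rook_laplacian_row by (simp add: algebra_simps)
    then show ?thesis by (simp add: sum_subtractf sum_distrib_left[symmetric] sum_distrib_right[symmetric])
  qed
  have column: "(\<Sum>j<m. ?C j * (\<Sum>i<n. rook_laplacian n m a i j)) = int m * (\<Sum>j<m. ?C j * ?c j) - ?d * ?s"
  proof -
    have "?C j * (\<Sum>i<n. rook_laplacian n m a i j) = int m * (?C j * ?c j) - ?C j * ?s" for j
      unfolding sum_rook_laplacian_column by (simp add: algebra_simps)
    moreover have "(\<Sum>j<m. ?C j) = ?d" by (rule sum.swap)
    ultimately show ?thesis
      by (simp add: sum_subtractf sum_distrib_left[symmetric] sum_distrib_right[symmetric])
  qed
  show ?thesis
    unfolding energy_def sum_mult_rook_laplacian row column by (simp add: algebra_simps)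
qed

text \<open>Expand the quadratic form and apply \<open>energy_rook_laplacian\<close>; the Laplacian
  has total 0. For the indicator \<open>a\<close> of a set, the first double sum counts the edges
  leaving the set; the others are the chips on the set, the degree and the size of the set.\<close>

lemma energy_fire:
  "energy n m (\<lambda>i j. D i j - rook_laplacian n m a i j) (\<lambda>i j. D i j - rook_laplacian n m a i j)
   = energy n m D D
     + int (n + m) * (int (n * m) * (\<Sum>i<n. \<Sum>j<m. a i j * rook_laplacian n m a i j)
         - 2 * (int (n * m) * (\<Sum>i<n. \<Sum>j<m. a i j * D i j)
                - (\<Sum>i<n. \<Sum>j<m. D i j) * (\<Sum>i<n. \<Sum>j<m. a i j)))"
proof -
  let ?L = "rook_laplacian n m a"
  have z: "(\<Sum>i<n. \<Sum>j<m. ?L i j) = 0"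
    unfolding sum_rook_laplacian_row by (simp add: sum_subtractf sum_distrib_left[symmetric])
  have "energy n m ?L ?L = int (n + m) * (int (n * m) * (\<Sum>i<n. \<Sum>j<m. a i j * ?L i j))"
    unfolding energy_rook_laplacian[of n m ?L a] z by (simp add: mult.commute)
  moreover have "energy n m D ?L = int (n + m) * (int (n * m) * (\<Sum>i<n. \<Sum>j<m. a i j * D i j)
       - (\<Sum>i<n. \<Sum>j<m. D i j) * (\<Sum>i<n. \<Sum>j<m. a i j))"
    unfolding energy_rook_laplacian by (simp add: mult.commute)
  ultimately show ?thesis
    unfolding energy_diff_left energy_diff_right energy_commute[of n m ?L D]
    by (simp add: algebra_simps)
qed

section \<open>Firing sets avoiding a poor row\<close>

text \<open>\<open>a\<close> is the indicator of a nonempty set that can be fired at once without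
  debt on the set; integer values make row and column sums into counts. Vertices outside the set
  only gain chips and carry no condition.\<close>

definition firable :: "nat \<Rightarrow> nat \<Rightarrow> (nat \<Rightarrow> nat \<Rightarrow> int) \<Rightarrow> (nat \<Rightarrow> nat \<Rightarrow> int) \<Rightarrow> bool" where
  "firable n m D a \<longleftrightarrow>
     (\<forall>i<n. \<forall>j<m. a i j = 0 \<or> a i j = 1) \<and> (\<exists>i<n. \<exists>j<m. a i j = 1) \<and>
     (\<forall>i<n. \<forall>j<m. a i j = 1 \<longrightarrow> rook_laplacian n m a i j \<le> D i j)"

text \<open>Carries results on rows over to columns.\<close>

lemma firable_transpose: "firable m n (\<lambda>j i. D i j) (\<lambda>j i. a i j) \<longleftrightarrow> firable n m D a"
  unfolding firable_def by (auto simp: rook_laplacian_transpose[of m n a])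

lemma sum_01_le:
  fixes f :: "nat \<Rightarrow> int"
  assumes "\<And>j. j < m \<Longrightarrow> f j = 0 \<or> f j = 1"
  shows "0 \<le> (\<Sum>j<m. f j)" "(\<Sum>j<m. f j) \<le> int m"
proof -
  show "0 \<le> (\<Sum>j<m. f j)" using assms by (intro sum_nonneg) force
  have "(\<Sum>j<m. f j) \<le> (\<Sum>j<m. 1)" using assms by (intro sum_mono) force
  then show "(\<Sum>j<m. f j) \<le> int m" by simp
qed

lemma sum_01_less:
  fixes f :: "nat \<Rightarrow> int"
  assumes "\<And>j. j < m \<Longrightarrow> f j = 0 \<or> f j = 1" and "j0 < m" "f j0 = 0"
  shows "(\<Sum>j<m. f j) < int m"
proof -
  have "(\<Sum>j<m. f j) < (\<Sum>j<m. 1)"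
    using assms by (intro sum_strict_mono_ex1) force+
  then show ?thesis by simp
qed

lemma sum_01_pos:
  fixes f :: "nat \<Rightarrow> int"
  assumes "\<And>j. j < m \<Longrightarrow> f j = 0 \<or> f j = 1" and "j0 < m" "f j0 = 1"
  shows "0 < (\<Sum>j<m. f j)"
  using assms by (intro sum_pos2[of _ j0]) force+

text \<open>The two sides differ by \<open>(c - 1) * (k - c - 1)\<close>. The product
  \<open>c * (k - c)\<close> counts the edges of a complete graph on \<open>k\<close> vertices
  between \<open>c\<close> of them and the rest.\<close>

lemma mult_diff_ge:
  fixes c :: int
  assumes "0 < c" "c < k"
  shows "k - 1 \<le> c * (k - c)"
proof -
  have "c * (k - c) - (k - 1) = (c - 1) * (k - c - 1)" by (simp add: algebra_simps)
  moreover have "\<dots> \<ge> 0" using assms by (intro mult_nonneg_nonneg) auto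
  ultimately show ?thesis by linarith
qed

text \<open>If the set met row \<open>i0\<close> in \<open>c\<close> vertices, each would need
  \<open>m - c\<close> chips for its neighbours in the row, at least \<open>m - 1\<close> in all.
  The row has at most \<open>m - 1\<close> chips, and the removal at \<open>j1\<close> takes one
  away unless the row is empty.\<close>

lemma firable_row_zero:
  assumes fire: "firable n m (\<lambda>i j. D i j - of_bool (i = i0 \<and> j = j0) - of_bool (i = i0 \<and> j = j1)) a"
    and idx: "i0 < n" "j0 < m" "j1 < m"
    and nonneg: "\<And>j. j < m \<Longrightarrow> D i0 j \<ge> 0"
    and row: "(\<Sum>j<m. D i0 j) < int m"
    and j0: "D i0 j0 = 0"
    and j1: "D i0 j1 > 0 \<or> (\<forall>j<m. D i0 j = 0)"
    and j: "j < m"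
  shows "a i0 j = 0"
proof (rule ccontr)
  assume nz: "a i0 j \<noteq> 0"
  let ?F = "\<lambda>j. D i0 j - of_bool (j = j0) - of_bool (j = j1)"
  let ?c = "\<Sum>j<m. a i0 j"
  have a01: "a i j = 0 \<or> a i j = 1" if "i < n" "j < m" for i j
    using fire that by (simp add: firable_def)
  have legal: "int m - ?c \<le> ?F j" if "j < m" "a i0 j = 1" for j
  proof -
    have "rook_laplacian n m a i0 j
            \<le> D i0 j - of_bool (i0 = i0 \<and> j = j0) - of_bool (i0 = i0 \<and> j = j1)"
      using fire idx that unfolding firable_def by blast
    moreover have "(\<Sum>i<n. a i j) \<le> int n" using a01 that by (intro sum_01_le) auto
    ultimately show ?thesis using that by (simp add: rook_laplacian_def)
  qed
  have "?c \<le> int m" using a01 idx by (intro sum_01_le) auto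
  \<comment> \<open>The vertex \<open>j0\<close> is in debt and cannot fire, so the row is not
    entirely in the set.\<close>
  moreover have "?F j0 < 0" using j0 by simp
  ultimately have "a i0 j0 \<noteq> 1" using legal[of j0] idx by linarith
  then have a0: "a i0 j0 = 0" using a01 idx by blast
  have "a i0 j = 1" using a01 idx j nz by blast
  then have c: "0 < ?c" "?c < int m"
    using sum_01_pos[of m "a i0" j, OF a01[OF idx(1)] j]
      sum_01_less[of m "a i0" j0, OF a01[OF idx(1)] idx(2) a0] by simp_all
  have "int m - 1 \<le> ?c * (int m - ?c)" by (rule mult_diff_ge[OF c])
  also have "\<dots> = (\<Sum>j<m. a i0 j * (int m - ?c))" by (simp add: sum_distrib_right)
  also have "\<dots> \<le> (\<Sum>j<m. a i0 j * ?F j)"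
  proof (intro sum_mono)
    fix j assume "j \<in> {..<m}"
    then show "a i0 j * (int m - ?c) \<le> a i0 j * ?F j"
      using legal[of j] a01[OF idx(1), of j] by (cases "a i0 j = 0") simp_all
  qed
  finally have ge: "int m - 1 \<le> (\<Sum>j<m. a i0 j * ?F j)" .
  show False
  proof (cases "\<forall>j<m. D i0 j = 0")
    case True
    then have "a i0 j * ?F j \<le> 0" if "j < m" for j using that a01[of i0 j] idx by auto
    then have "(\<Sum>j<m. a i0 j * ?F j) \<le> 0" by (intro sum_nonpos) auto
    then show False using ge c by linarith
  next
    case False
    then have pos: "D i0 j1 > 0" using j1 by blast
    \<comment> \<open>Since \<open>j0\<close> does not fire, its debt must not be counted; here
      \<open>j0\<close> and \<open>j1\<close> differ, and away from \<open>j0\<close> no entry of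
      \<open>?F\<close> is negative.\<close>
    have "a i0 j * ?F j \<le> ?F j + of_bool (j = j0)" if "j < m" for j
      using that a01[of i0 j] a0 idx pos j0 nonneg[of j] by auto
    then have "(\<Sum>j<m. a i0 j * ?F j) \<le> (\<Sum>j<m. ?F j + of_bool (j = j0))"
      by (intro sum_mono) auto
    also have "\<dots> = (\<Sum>j<m. D i0 j) - 1"
      using idx by (simp add: sum_subtractf of_bool_def)
    finally show False using ge row by linarith
  qed
qed

text \<open>The set misses row \<open>i0\<close>, so no column is full, and the bound on its edge
  boundary forces a full row. That makes every column partial, and the boundary within columns
  nearly exhausts the degree, leaving too little for a partial row. So the set is a union of rows,
  and the bound leaves \<open>i0\<close> as the only row outside it.\<close>

lemma firable_avoiding_row:
  assumes fire: "firable n m F a"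
    and F: "\<And>i j. i < n \<Longrightarrow> j < m \<Longrightarrow> F i j \<le> D i j"
    and nonneg: "\<And>i j. i < n \<Longrightarrow> j < m \<Longrightarrow> D i j \<ge> 0"
    and degree: "(\<Sum>i<n. \<Sum>j<m. D i j) \<le> int (n * m) - 2"
    and cut: "(\<Sum>i<n. \<Sum>j<m. a i j * rook_laplacian n m a i j) < 2 * (\<Sum>i<n. \<Sum>j<m. a i j)"
    and i0: "i0 < n" "\<And>j. j < m \<Longrightarrow> a i0 j = 0"
    and i: "i < n" "i \<noteq> i0" and j: "j < m"
  shows "D i j \<ge> 1"
proof -
  let ?c = "\<lambda>i. \<Sum>j<m. a i j" and ?b = "\<lambda>j. \<Sum>i<n. a i j"
  let ?cut = "\<Sum>i<n. \<Sum>j<m. a i j * rook_laplacian n m a i j"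
  have m: "m > 0" using j by simp
  have a01: "a i j = 0 \<or> a i j = 1" if "i < n" "j < m" for i j
    using fire that by (simp add: firable_def)
  have sq: "a i j * a i j = a i j" if "i < n" "j < m" for i j
    using a01[OF that] by auto
  have swap: "(\<Sum>j<m. ?b j) = (\<Sum>i<n. ?c i)" by (rule sum.swap)
  have c: "0 \<le> ?c i" "?c i \<le> int m" if "i < n" for i
  proof -
    show "0 \<le> ?c i" by (rule sum_01_le, rule a01) (use that in simp_all)
    show "?c i \<le> int m" by (rule sum_01_le, rule a01) (use that in simp_all)
  qed
  have b: "0 \<le> ?b j" "?b j < int n" if "j < m" for j
  proof -
    show "0 \<le> ?b j" by (rule sum_01_le, rule a01) (use that in simp_all)
    show "?b j < int n" by (rule sum_01_less, rule a01) (use that i0 in simp_all)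
  qed
  \<comment> \<open>Boundary edges are counted row by row and column by column, each being a
    complete graph.\<close>
  have cut_eq: "?cut = (\<Sum>i<n. ?c i * (int m - ?c i)) + (\<Sum>j<m. ?b j * (int n - ?b j))"
  proof -
    have "(\<Sum>i<n. \<Sum>j<m. a i j * a i j) = (\<Sum>i<n. ?c i)"
      by (intro sum.cong refl) (simp add: sq)
    then have "?cut = int (n + m) * (\<Sum>i<n. ?c i) - (\<Sum>i<n. ?c i * ?c i) - (\<Sum>j<m. ?b j * ?b j)"
      by (simp only: sum_mult_rook_laplacian)
    moreover have "(\<Sum>i<n. ?c i * (int m - ?c i)) = int m * (\<Sum>i<n. ?c i) - (\<Sum>i<n. ?c i * ?c i)"
      by (simp add: right_diff_distrib sum_subtractf sum_distrib_left mult.commute)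
    moreover have "(\<Sum>j<m. ?b j * (int n - ?b j)) = int n * (\<Sum>j<m. ?b j) - (\<Sum>j<m. ?b j * ?b j)"
      by (simp add: right_diff_distrib sum_subtractf sum_distrib_left mult.commute)
    ultimately show ?thesis by (simp add: swap algebra_simps)
  qed
  have b_ge: "?b j \<le> ?b j * (int n - ?b j)" if "j < m" for j
    using b[OF that] by (simp add: mult_le_cancel_left1)
  \<comment> \<open>Without a full row, each row and each column has at least as many boundary edges
    as fired vertices, so the boundary is at least twice the size of the set.\<close>
  have "\<exists>i1<n. ?c i1 = int m"
  proof (rule ccontr)
    assume neg: "\<not> ?thesis"
    have "?c i \<le> ?c i * (int m - ?c i)" if "i < n" for i
    proof -
      have "?c i < int m" using c[OF that] neg that by (meson order_le_less)
      then show ?thesis using c[OF that] by (simp add: mult_le_cancel_left1)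
    qed
    then have "(\<Sum>i<n. ?c i) + (\<Sum>j<m. ?b j) \<le> ?cut"
      unfolding cut_eq by (intro add_mono sum_mono) (simp_all only: lessThan_iff b_ge)
    then show False using cut swap by linarith
  qed
  then obtain i1 where i1: "i1 < n" "?c i1 = int m" by blast
  have a1: "a i1 j = 1" if "j < m" for j
    using sum_01_less[of m "a i1" j, OF a01[OF i1(1)] that] a01[OF i1(1) that] i1(2) by auto
  have b_pos: "0 < ?b j" if "j < m" for j
    using sum_01_pos[of n "\<lambda>i. a i j" i1, OF a01[OF _ that] i1(1) a1[OF that]] by simp
  have "int m * (int n - 1) = (\<Sum>j<m. int n - 1)" by simp
  also have "\<dots> \<le> (\<Sum>j<m. ?b j * (int n - ?b j))"
    by (intro sum_mono mult_diff_ge) (simp_all only: lessThan_iff b b_pos)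
  finally have b_sum: "int m * (int n - 1) \<le> (\<Sum>j<m. ?b j * (int n - ?b j))" .
  \<comment> \<open>Summing the firing condition bounds the boundary by the degree, at most
    \<open>n * m - 2\<close>. The columns use at least \<open>m * (n - 1)\<close> of it, so
    \<open>m - 2\<close> remains for the rows, below the cost \<open>m - 1\<close> of one partial
    row.\<close>
  have "?cut \<le> (\<Sum>i<n. \<Sum>j<m. D i j)"
  proof (intro sum_mono)
    fix i j assume ij: "i \<in> {..<n}" "j \<in> {..<m}"
    then have "a i j = 1 \<longrightarrow> rook_laplacian n m a i j \<le> F i j" using fire by (simp add: firable_def)
    then show "a i j * rook_laplacian n m a i j \<le> D i j"
      using a01[of i j] F[of i j] nonneg[of i j] ij by auto
  qed
  then have c_sum: "(\<Sum>i<n. ?c i * (int m - ?c i)) \<le> int m - 2"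
    using degree b_sum unfolding cut_eq by (simp add: algebra_simps)
  have c_full: "?c i = 0 \<or> ?c i = int m" if "i < n" for i
  proof (rule ccontr)
    assume "\<not> ?thesis"
    then have "int m - 1 \<le> ?c i * (int m - ?c i)" using c[OF that] by (intro mult_diff_ge) auto
    also have "\<dots> \<le> (\<Sum>i<n. ?c i * (int m - ?c i))"
      by (rule member_le_sum[where f = "\<lambda>i. ?c i * (int m - ?c i)"]) (use that c in simp_all)
    finally show False using c_sum by linarith
  qed
  have const: "a i j = a i 0" if "i < n" "j < m" for i j
  proof (cases "?c i = 0")
    case True
    then have "a i j = 0" if "j < m" for j
      using sum_01_pos[of m "a i" j] a01[OF \<open>i < n\<close>] that by fastforce
    then show ?thesis using that m by simp
  next
    case False
    then have "?c i = int m" using c_full that by blast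
    then have "a i j = 1" if "j < m" for j
      using sum_01_less[of m "a i" j] a01[OF \<open>i < n\<close>] that by fastforce
    then show ?thesis using that m by simp
  qed
  define k where "k = ?b 0"
  have b_const: "?b j = k" if "j < m" for j
    unfolding k_def using that by (intro sum.cong refl const) auto
  have k: "0 < k" "k < int n" unfolding k_def using b[OF m] b_pos[OF m] by simp_all
  have "?cut \<ge> (\<Sum>j<m. ?b j * (int n - ?b j))"
    unfolding cut_eq using sum_nonneg[of "{..<n}" "\<lambda>i. ?c i * (int m - ?c i)"] c by simp
  also have "(\<Sum>j<m. ?b j * (int n - ?b j)) = (\<Sum>j<m. k * (int n - k))"
    by (intro sum.cong refl) (simp add: b_const)
  also have "\<dots> = int m * k * (int n - k)" by simp
  finally have "int m * k * (int n - k) \<le> ?cut" .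
  moreover have "(\<Sum>i<n. ?c i) = int m * k"
  proof -
    have "(\<Sum>j<m. ?b j) = (\<Sum>j<m. k)"
      by (intro sum.cong refl) (simp add: b_const)
    then show ?thesis by (simp add: swap)
  qed
  \<comment> \<open>Cancelling \<open>m * k\<close> gives \<open>n - k < 2\<close>: exactly one row
    is not fired.\<close>
  ultimately have "int m * k * (int n - k) < int m * k * 2"
    using cut by (simp only: mult.commute[of 2])
  then have k_eq: "k = int n - 1"
    using k m by (simp add: mult_less_cancel_left)
  have "a i 0 = 1"
  proof (rule ccontr)
    assume "a i 0 \<noteq> 1"
    then have "a i 0 = 0" using a01 i m by blast
    then have "k \<le> (\<Sum>i'<n. 1 - of_bool (i' = i) - of_bool (i' = i0))"
      unfolding k_def
    proof (intro sum_mono)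
      fix i' assume "i' \<in> {..<n}"
      then show "a i' 0 \<le> 1 - of_bool (i' = i) - of_bool (i' = i0)"
        using a01[of i' 0] i0(2)[OF m] \<open>a i 0 = 0\<close> i(2) m by auto
    qed
    also have "\<dots> = int n - 2" using i i0 by (simp add: sum_subtractf of_bool_def)
    finally show False using k_eq by linarith
  qed
  then have aij: "a i j = 1" using const[OF i(1) j] by simp
  then have "?c i = int m"
    using c_full[OF i(1)] sum_01_pos[of m "a i" j, OF a01[OF i(1)] j] by simp
  \<comment> \<open>The only unfired neighbour lies in row \<open>i0\<close> of the same column:
    \<open>(n + m) - m - (n - 1) = 1\<close>.\<close>
  then have "rook_laplacian n m a i j = 1"
    using aij b_const[OF j] k_eq by (simp add: rook_laplacian_def)
  moreover have "rook_laplacian n m a i j \<le> F i j"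
    using fire aij i j unfolding firable_def by blast
  ultimately show ?thesis using F[OF i(1) j] by linarith
qed

text \<open>Applying \<open>fire\<close> to two chips of row \<open>i0\<close> yields a set that
  avoids this row by \<open>firable_row_zero\<close>.\<close>

lemma poor_row:
  assumes fire: "\<And>i j i' j'. i < n \<Longrightarrow> j < m \<Longrightarrow> i' < n \<Longrightarrow> j' < m \<Longrightarrow>
      \<exists>a. firable n m (\<lambda>k l. D k l - of_bool (k = i \<and> l = j) - of_bool (k = i' \<and> l = j')) a \<and>
          (\<Sum>i<n. \<Sum>j<m. a i j * rook_laplacian n m a i j) < 2 * (\<Sum>i<n. \<Sum>j<m. a i j)"
    and nonneg: "\<And>i j. i < n \<Longrightarrow> j < m \<Longrightarrow> D i j \<ge> 0"
    and degree: "(\<Sum>i<n. \<Sum>j<m. D i j) \<le> int (n * m) - 2"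
    and row: "i0 < n" "(\<Sum>j<m. D i0 j) < int m"
    and i: "i < n" "i \<noteq> i0" and j: "j < m"
  shows "D i j \<ge> 1"
proof -
  have "\<exists>j0<m. D i0 j0 = 0"
  proof (rule ccontr)
    assume "\<not> ?thesis"
    then have "D i0 j \<ge> 1" if "j < m" for j using nonneg[OF row(1) that] that by force
    then have "(\<Sum>j<m. 1) \<le> (\<Sum>j<m. D i0 j)" by (intro sum_mono) auto
    then show False using row by simp
  qed
  then obtain j0 where j0: "j0 < m" "D i0 j0 = 0" by blast
  \<comment> \<open>In an empty row \<open>j0\<close> itself can serve as \<open>j1\<close>.\<close>
  obtain j1 where j1: "j1 < m" "D i0 j1 > 0 \<or> (\<forall>j<m. D i0 j = 0)"
    using j0 nonneg[OF row(1)] by (metis order_le_less)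
  obtain a where a: "firable n m
        (\<lambda>k l. D k l - of_bool (k = i0 \<and> l = j0) - of_bool (k = i0 \<and> l = j1)) a"
      "(\<Sum>i<n. \<Sum>j<m. a i j * rook_laplacian n m a i j) < 2 * (\<Sum>i<n. \<Sum>j<m. a i j)"
    using fire[OF row(1) j0(1) row(1) j1(1)] by blast
  show ?thesis
  proof (rule firable_avoiding_row[OF a(1) _ nonneg degree a(2) row(1) _ i j])
    show "a i0 j = 0" if "j < m" for j
      using firable_row_zero[OF a(1) row(1) j0(1) j1(1) nonneg[OF row(1)] row(2) j0(2) j1(2) that] .
  qed auto
qed

lemma exists_poor_row:
  fixes D :: "nat \<Rightarrow> nat \<Rightarrow> int"
  assumes "(\<Sum>i<n. \<Sum>j<m. D i j) < int (n * m)"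
  shows "\<exists>i<n. (\<Sum>j<m. D i j) < int m"
proof (rule ccontr)
  assume "\<not> ?thesis"
  then have "(\<Sum>i<n. int m) \<le> (\<Sum>i<n. \<Sum>j<m. D i j)" by (intro sum_mono) force
  then show False using assms by simp
qed

lemma degree_ge:
  assumes fire: "\<And>i j i' j'. i < n \<Longrightarrow> j < m \<Longrightarrow> i' < n \<Longrightarrow> j' < m \<Longrightarrow>
      \<exists>a. firable n m (\<lambda>k l. D k l - of_bool (k = i \<and> l = j) - of_bool (k = i' \<and> l = j')) a \<and>
          (\<Sum>i<n. \<Sum>j<m. a i j * rook_laplacian n m a i j) < 2 * (\<Sum>i<n. \<Sum>j<m. a i j)"
    and nonneg: "\<And>i j. i < n \<Longrightarrow> j < m \<Longrightarrow> D i j \<ge> 0"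
  shows "(\<Sum>i<n. \<Sum>j<m. D i j) \<ge> int (n * m) - 1"
proof (rule ccontr)
  assume "\<not> ?thesis"
  then have degree: "(\<Sum>i<n. \<Sum>j<m. D i j) \<le> int (n * m) - 2" by linarith
  moreover have "(\<Sum>j<m. \<Sum>i<n. D i j) = (\<Sum>i<n. \<Sum>j<m. D i j)" by (rule sum.swap)
  ultimately have degree': "(\<Sum>j<m. \<Sum>i<n. D i j) \<le> int (m * n) - 2"
    by (simp only: mult.commute[of m n])
  obtain i0 where i0: "i0 < n" "(\<Sum>j<m. D i0 j) < int m"
    using exists_poor_row[where n = n and m = m and D = D] degree by auto
  obtain j0 where j0: "j0 < m" "(\<Sum>i<n. D i j0) < int n"
    using exists_poor_row[where n = m and m = n and D = "\<lambda>j i. D i j"] degree' by auto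
  have row: "D i j \<ge> 1" if "i < n" "i \<noteq> i0" "j < m" for i j
    using poor_row[OF fire nonneg degree i0 that] by blast
  have column: "D i j \<ge> 1" if "j < m" "j \<noteq> j0" "i < n" for i j
  \<comment> \<open>The row argument is applied to the transposed grid.\<close>
  proof (rule poor_row[of m n "\<lambda>j i. D i j", OF _ _ degree' j0 that])
    fix j i j' i' assume "j < m" "i < n" "j' < m" "i' < n"
    then obtain a where
      "firable n m (\<lambda>k l. D k l - of_bool (k = i \<and> l = j) - of_bool (k = i' \<and> l = j')) a"
      and cut: "(\<Sum>i<n. \<Sum>j<m. a i j * rook_laplacian n m a i j) < 2 * (\<Sum>i<n. \<Sum>j<m. a i j)"
      using fire by blast
    then have "firable m n (\<lambda>l k. D k l - of_bool (l = j \<and> k = i) - of_bool (l = j' \<and> k = i')) (\<lambda>j i. a i j)"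
      by (subst firable_transpose) (simp add: conj_commute)
    moreover have "(\<Sum>j<m. \<Sum>i<n. a i j * rook_laplacian m n (\<lambda>j i. a i j) j i)
                     = (\<Sum>i<n. \<Sum>j<m. a i j * rook_laplacian n m a i j)"
      by (subst sum.swap, subst rook_laplacian_transpose) (rule refl)
    moreover have "(\<Sum>j<m. \<Sum>i<n. a i j) = (\<Sum>i<n. \<Sum>j<m. a i j)" by (rule sum.swap)
    moreover note cut
    ultimately show "\<exists>a. firable m n (\<lambda>k l. D l k - of_bool (k = j \<and> l = i) - of_bool (k = j' \<and> l = i')) a \<and>
        (\<Sum>i<m. \<Sum>j<n. a i j * rook_laplacian m n a i j) < 2 * (\<Sum>i<m. \<Sum>j<n. a i j)"
      by (intro exI[of _ "\<lambda>j i. a i j"] conjI) simp_all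
  qed (use nonneg in auto)
  \<comment> \<open>Only \<open>(i0, j0)\<close> lies in both the poor row and the poor column, so
    every other vertex carries a chip.\<close>
  have "(\<Sum>i<n. \<Sum>j<m. 1 - of_bool (i = i0 \<and> j = j0)) \<le> (\<Sum>i<n. \<Sum>j<m. D i j)"
  proof (intro sum_mono)
    fix i j assume "i \<in> {..<n}" "j \<in> {..<m}"
    then show "1 - of_bool (i = i0 \<and> j = j0) \<le> D i j"
      using row[of i j] column[of j i] nonneg[of i j] by auto
  qed
  moreover have "(\<Sum>i<n. \<Sum>j<m. 1 - of_bool (i = i0 \<and> j = j0) :: int) = int (n * m) - 1"
  proof -
    have "(\<Sum>j<m. of_bool (i = i0 \<and> j = j0) :: int) = of_bool (i = i0)" for i
      using j0 by (cases "i = i0") (simp_all add: of_bool_def)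
    then show ?thesis using i0 by (simp add: sum_subtractf of_bool_def)
  qed
  ultimately show False using degree by linarith
qed

section \<open>Divisors on the rook graph\<close>

lemma deg_rook: "deg (rook n m) D = (\<Sum>i<n. \<Sum>j<m. D (i, j))"
  by (simp add: deg_def verts_rook sum.cartesian_product)

section \<open>Lower bound for rank 2 by minimizing energy\<close>

lemma energy_cong:
  assumes "\<And>i j. i < n \<Longrightarrow> j < m \<Longrightarrow> D i j = D' i j"
  shows "energy n m D D = energy n m D' D'"
proof -
  have "(\<Sum>j<m. D i j) = (\<Sum>j<m. D' i j)" "(\<Sum>j<m. D i j * D i j) = (\<Sum>j<m. D' i j * D' i j)"
    if "i < n" for i using assms that by simp_all
  moreover have "(\<Sum>i<n. D i j) = (\<Sum>i<n. D' i j)" if "j < m" for j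
    using assms that by simp
  ultimately show ?thesis by (simp add: energy_def)
qed

text \<open>Outside \<open>A\<close> the Laplacian of the indicator is at most 0, so these vertices
  lose nothing.\<close>

lemma (in connected_multigraph) effective_fire_indicator:
  assumes "effective G D" "\<And>v. v \<in> A \<Longrightarrow> laplacian G (\<lambda>w. of_bool (w \<in> A)) v \<le> D v"
  shows "effective G (\<lambda>v. D v - laplacian G (\<lambda>w. of_bool (w \<in> A)) v)"
  unfolding effective_def
proof (intro conjI ballI)
  show "(\<lambda>v. D v - laplacian G (\<lambda>w. of_bool (w \<in> A)) v) \<in> divisors G"
    using assms(1) by (simp add: effective_def divisors_def laplacian_eq_0)
  fix v assume v: "v \<in> verts G"
  show "0 \<le> D v - laplacian G (\<lambda>w. of_bool (w \<in> A)) v"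
  proof (cases "v \<in> A")
    case False
    then have "laplacian G (\<lambda>w. of_bool (w \<in> A)) v \<le> 0"
      unfolding laplacian_def by (intro sum_nonpos) simp
    moreover have "0 \<le> D v" using assms(1) v by (simp add: effective_def)
    ultimately show ?thesis by simp
  qed (use assms(2) in simp)
qed

text \<open>In an effective divisor of least energy in its class, firing a legal set cannot lower
  the energy. With degree below \<open>n * m\<close>, \<open>energy_fire\<close> turns this into the
  boundary bound that \<open>degree_ge\<close> requires.\<close>

lemma degree_ge_of_rank_2:
  assumes "n \<ge> 1" "m \<ge> 1" and rank: "rank_at_least (rook n m) 2 D"
  shows "deg (rook n m) D \<ge> int (n * m) - 1"
proof (rule ccontr)
  assume small: "\<not> ?thesis"
  interpret connected_multigraph "rook n m"
    using assms by (intro connected_multigraph_rook)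
  define P where "P D' \<longleftrightarrow> effective (rook n m) D' \<and> equivalent (rook n m) D D'" for D'
  \<comment> \<open>Energies are nonnegative, so \<open>nat\<close> loses nothing and makes a
    minimum available.\<close>
  define \<Phi> where "\<Phi> D' = nat (energy n m (curry D') (curry D'))" for D'
  have "\<exists>D'. P D'" using rank_at_least_imp_effective[OF rank] by (simp add: P_def)
  then obtain D1 where D1: "P D1" and min: "\<And>D'. P D' \<Longrightarrow> \<Phi> D1 \<le> \<Phi> D'"
    using ex_has_least_nat[of P _ \<Phi>] by blast
  have eff: "effective (rook n m) D1" and eq: "equivalent (rook n m) D D1"
    using D1 by (simp_all add: P_def)
  have rank1: "rank_at_least (rook n m) 2 D1" by (rule rank_at_least_equivalent[OF eq rank])
  have deg1: "(\<Sum>i<n. \<Sum>j<m. D1 (i, j)) = deg (rook n m) D"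
    using equivalent_deg[OF eq] by (simp add: deg_rook)
  have "int (n * m) - 1 \<le> (\<Sum>i<n. \<Sum>j<m. curry D1 i j)"
  proof (rule degree_ge)
    show "curry D1 i j \<ge> 0" if "i < n" "j < m" for i j
      using eff that by (simp add: effective_def verts_rook)
    fix i j i' j' assume idx: "i < n" "j < m" "i' < n" "j' < m"
    \<comment> \<open>A sum of two indicators has degree 2 even when both chips come from the same
      vertex.\<close>
    define E :: "nat \<times> nat \<Rightarrow> int" where "E = (\<lambda>v. of_bool (v = (i, j)) + of_bool (v = (i', j')))"
    have "effective (rook n m) E"
      using idx by (auto simp: E_def effective_def divisors_def verts_rook)
    moreover have "deg (rook n m) E = int 2"
      unfolding E_def deg_add using idx by (simp add: deg_of_bool verts_rook)
    ultimately obtain D' where D': "effective (rook n m) D'" "equivalent (rook n m) (\<lambda>v. D1 v - E v) D'"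
      using rank1 unfolding rank_at_least_def by blast
    obtain A where A: "A \<subseteq> verts (rook n m)" "A \<noteq> {}"
      and legal: "\<And>v. v \<in> A \<Longrightarrow> laplacian (rook n m) (\<lambda>w. of_bool (w \<in> A)) v \<le> D1 v - E v"
      using legal_set_exists[OF D'(2,1)] by blast
    define a :: "nat \<Rightarrow> nat \<Rightarrow> int" where "a = curry (\<lambda>w. of_bool (w \<in> A))"
    have lap: "laplacian (rook n m) (\<lambda>w. of_bool (w \<in> A)) (k, l) = rook_laplacian n m a k l"
      if "k < n" "l < m" for k l
      using laplacian_rook[OF that] by (simp add: a_def)
    have a_legal: "rook_laplacian n m a k l \<le> D1 (k, l) - E (k, l)"
      if "k < n" "l < m" "a k l = 1" for k l
      using legal[of "(k, l)"] lap that by (simp add: a_def)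
    have E_nonneg: "E v \<ge> 0" for v by (simp add: E_def)
    obtain k0 l0 where kl0: "k0 < n" "l0 < m" "(k0, l0) \<in> A"
      using A by (auto simp: verts_rook)
    have "firable n m (\<lambda>k l. curry D1 k l - of_bool (k = i \<and> l = j) - of_bool (k = i' \<and> l = j')) a"
      unfolding firable_def
    proof (intro conjI allI impI)
      show "\<exists>i<n. \<exists>j<m. a i j = 1" using kl0 by (auto simp: a_def)
      show "rook_laplacian n m a k l
              \<le> curry D1 k l - of_bool (k = i \<and> l = j) - of_bool (k = i' \<and> l = j')"
        if "k < n" "l < m" "a k l = 1" for k l
        using a_legal[OF that] by (simp add: E_def)
    qed (simp add: a_def)
    moreover have "(\<Sum>i<n. \<Sum>j<m. a i j * rook_laplacian n m a i j) < 2 * (\<Sum>i<n. \<Sum>j<m. a i j)"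
    proof -
      let ?cut = "\<Sum>i<n. \<Sum>j<m. a i j * rook_laplacian n m a i j"
      let ?s = "\<Sum>i<n. \<Sum>j<m. a i j" and ?d = "\<Sum>i<n. \<Sum>j<m. curry D1 i j"
      let ?aD = "\<Sum>i<n. \<Sum>j<m. a i j * curry D1 i j"
      define D2 where "D2 = (\<lambda>v. D1 v - laplacian (rook n m) (\<lambda>w. of_bool (w \<in> A)) v)"
      \<comment> \<open>A set legal after removing \<open>E\<close> is legal for \<open>D1\<close>
        as well, so \<open>D2\<close> competes with \<open>D1\<close> for least energy.\<close>
      have "laplacian (rook n m) (\<lambda>w. of_bool (w \<in> A)) v \<le> D1 v" if "v \<in> A" for v
        using legal[OF that] E_nonneg[of v] by linarith
      then have "effective (rook n m) D2"
        unfolding D2_def by (rule effective_fire_indicator[OF eff])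
      moreover have "equivalent (rook n m) D D2"
        using eq equivalent_fire_indicator[OF A(1), of D1] unfolding D2_def equivalent_def
        by (rule rtranclp_trans)
      ultimately have "\<Phi> D1 \<le> \<Phi> D2" by (intro min) (simp add: P_def)
      then have "energy n m (curry D1) (curry D1) \<le> energy n m (curry D2) (curry D2)"
        using energy_nonneg[of n m "curry D2"] by (simp add: \<Phi>_def)
      also have "energy n m (curry D2) (curry D2)
          = energy n m (\<lambda>i j. curry D1 i j - rook_laplacian n m a i j)
              (\<lambda>i j. curry D1 i j - rook_laplacian n m a i j)"
        \<comment> \<open>\<open>rook_laplacian\<close> agrees with the Laplacian only on the grid,
          the only place where \<open>energy\<close> looks.\<close>
        by (rule energy_cong) (simp add: D2_def lap)
      finally have "0 \<le> int (n + m) * (int (n * m) * ?cut - 2 * (int (n * m) * ?aD - ?d * ?s))"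
        unfolding energy_fire by linarith
      then have "0 \<le> int (n * m) * ?cut - 2 * (int (n * m) * ?aD - ?d * ?s)"
        using assms by (simp add: zero_le_mult_iff)
      moreover have "int (n * m) * ?cut \<le> int (n * m) * ?aD"
      proof (rule mult_left_mono, intro sum_mono)
        fix k l assume "k \<in> {..<n}" "l \<in> {..<m}"
        then show "a k l * rook_laplacian n m a k l \<le> a k l * curry D1 k l"
          using a_legal[of k l] E_nonneg[of "(k, l)"]
          by (cases "(k, l) \<in> A") (simp_all add: a_def)
      qed simp
      moreover have "?d * ?s < int (n * m) * ?s"
      proof (rule mult_strict_right_mono)
        show "?d < int (n * m)" using deg1 small by simp
        have a_nonneg: "0 \<le> a k l" for k l by (simp add: a_def)
        have "0 < (\<Sum>j<m. a k0 j)"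
          using kl0 a_nonneg by (intro sum_pos2[of _ l0]) (simp_all add: a_def)
        then show "0 < ?s"
          using kl0 a_nonneg by (intro sum_pos2[of _ k0 "\<lambda>k. \<Sum>l<m. a k l"] sum_nonneg) simp_all
      qed
      \<comment> \<open>Here \<open>x\<close> is the boundary and \<open>y\<close> the chips on the
        set, both times \<open>n * m\<close>; \<open>z\<close> is degree times size, and
        \<open>w\<close> is \<open>n * m\<close> times size. Then
        \<open>2 * x \<le> 2 * y \<le> x + 2 * z\<close>, so
        \<open>x \<le> 2 * z < 2 * w\<close>.\<close>
      moreover have "x < 2 * w" if "0 \<le> x - 2 * (y - z)" "x \<le> y" "z < w" for x y z w :: int
        using that by presburger
      ultimately have "int (n * m) * ?cut < 2 * (int (n * m) * ?s)" by blast
      then have "int (n * m) * ?cut < int (n * m) * (2 * ?s)" by (simp only: mult.left_commute)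
      then show ?thesis by (rule mult_left_less_imp_less) simp
    qed
    ultimately show "\<exists>a. firable n m
          (\<lambda>k l. curry D1 k l - of_bool (k = i \<and> l = j) - of_bool (k = i' \<and> l = j')) a \<and>
        (\<Sum>i<n. \<Sum>j<m. a i j * rook_laplacian n m a i j) < 2 * (\<Sum>i<n. \<Sum>j<m. a i j)"
      by blast
  qed
  then show False using deg1 small by simp
qed

section \<open>Upper bound: one chip on every vertex\<close>

definition all_ones :: "nat \<Rightarrow> nat \<Rightarrow> nat \<times> nat \<Rightarrow> int" where
  "all_ones n m v = of_bool (v \<in> {..<n} \<times> {..<m})"

lemma all_ones_divisors: "all_ones n m \<in> divisors (rook n m)"
  by (auto simp: all_ones_def divisors_def verts_rook)

lemma deg_all_ones: "deg (rook n m) (all_ones n m) = int (n * m)"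
  by (simp add: deg_rook all_ones_def)

lemma sum_of_bool_eq:
  fixes i0 :: nat
  shows "i0 < n \<Longrightarrow> (\<Sum>i<n. of_bool (i = i0) :: int) = 1"
  by (simp add: of_bool_def)

text \<open>At most one vertex loses two or more of the three chips. If a chip is also taken
  elsewhere in its row or column, that whole line borrows; otherwise the vertex alone does.\<close>

lemma rank_all_ones:
  assumes n: "n \<ge> 2" and m: "m \<ge> 2"
  shows "rank_at_least (rook n m) 3 (all_ones n m)"
  unfolding rank_at_least_def
proof (intro allI impI)
  interpret connected_multigraph "rook n m"
    using n m by (intro connected_multigraph_rook) auto
  let ?V = "verts (rook n m)"
  fix E assume E: "effective (rook n m) E \<and> deg (rook n m) E = int 3"
  let ?F = "\<lambda>v. all_ones n m v - E v"
  let ?goal = "\<exists>D'. effective (rook n m) D' \<and> equivalent (rook n m) ?F D'"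
  have E0: "E v \<ge> 0" for v
    using E unfolding effective_def divisors_def by (cases v; cases "v \<in> ?V") auto
  have E_le: "(\<Sum>v\<in>S. E v) \<le> 3" if "S \<subseteq> ?V" for S
    using sum_mono2[OF finite_verts that, of E] E0 E by (simp add: deg_def)
  have F: "?F \<in> divisors (rook n m)"
    using E all_ones_divisors[of n m] by (simp add: effective_def divisors_def)
  \<comment> \<open>All of \<open>B\<close> borrows, that is, its complement fires; the right-hand
    side of \<open>pos\<close> is the resulting count before \<open>E\<close> is taken off.\<close>
  have unfire: ?goal if B: "B \<subseteq> ?V"
    and pos: "\<And>i j. i < n \<Longrightarrow> j < m \<Longrightarrow>
      E (i, j) \<le> 1 + rook_laplacian n m (\<lambda>i j. of_bool ((i, j) \<in> B)) i j" for B
  proof (intro exI conjI)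
    show "equivalent (rook n m) ?F (\<lambda>v. ?F v + laplacian (rook n m) (\<lambda>w. of_bool (w \<in> B)) v)"
      by (rule equivalent_unfire_indicator[OF B])
    show "effective (rook n m) (\<lambda>v. ?F v + laplacian (rook n m) (\<lambda>w. of_bool (w \<in> B)) v)"
      unfolding effective_def
    proof (intro conjI ballI)
      show "(\<lambda>v. ?F v + laplacian (rook n m) (\<lambda>w. of_bool (w \<in> B)) v) \<in> divisors (rook n m)"
        using F by (simp add: divisors_def laplacian_eq_0)
      fix v assume "v \<in> ?V"
      then obtain i j where v: "v = (i, j)" "i < n" "j < m" by (auto simp: verts_rook)
      then show "0 \<le> ?F v + laplacian (rook n m) (\<lambda>w. of_bool (w \<in> B)) v"
        using pos[of i j] laplacian_rook[of i n j m "\<lambda>w. of_bool (w \<in> B)"]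
        by (simp add: all_ones_def curry_def)
    qed
  qed
  show ?goal
  proof (cases "\<forall>v\<in>?V. E v \<le> 1")
    case True
    then have "E (i, j) \<le> 1" if "i < n" "j < m" for i j using that by (simp add: verts_rook)
    then show ?goal by (intro unfire[of "{}"]) (simp_all add: rook_laplacian_def)
  next
    case False
    then obtain i0 j0 where v: "i0 < n" "j0 < m" "E (i0, j0) \<ge> 2" by (force simp: verts_rook)
    have others: "E u + E w \<le> 1" if "u \<in> ?V" "w \<in> ?V" "u \<noteq> (i0, j0)" "w \<noteq> (i0, j0)" "u \<noteq> w" for u w
      using E_le[of "{(i0, j0), u, w}"] that v by (simp add: verts_rook)
    have other: "E u \<le> 1" if "u \<in> ?V" "u \<noteq> (i0, j0)" for u
      using E_le[of "{(i0, j0), u}"] that v by (simp add: verts_rook)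
    have E3: "E (i0, j0) \<le> 3" using E_le[of "{(i0, j0)}"] v by (simp add: verts_rook)
    consider (row) j1 where "j1 < m" "j1 \<noteq> j0" "E (i0, j1) \<ge> 1"
      | (column) i1 where "i1 < n" "i1 \<noteq> i0" "E (i1, j0) \<ge> 1"
      | (vertex) "\<And>j. j < m \<Longrightarrow> j \<noteq> j0 \<Longrightarrow> E (i0, j) \<le> 0" "\<And>i. i < n \<Longrightarrow> i \<noteq> i0 \<Longrightarrow> E (i, j0) \<le> 0"
      by force
    then show ?goal
    proof cases
      case row
      \<comment> \<open>Row \<open>i0\<close> absorbs all three chips of \<open>E\<close>. Borrowing
        gives its vertices \<open>n - 1\<close> chips each and costs every other vertex its single
        chip, where nothing is owed.\<close>
      have "E (i0, j0) \<le> 2"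
        using E_le[of "{(i0, j0), (i0, j1)}"] row v by (simp add: verts_rook)
      then have "E (i, j) \<le> int n * of_bool (i = i0)" if "i < n" "j < m" for i j
        using others[of "(i, j)" "(i0, j1)"] other[of "(i, j)"] row v n that E0[of "(i, j)"]
        by (cases "i = i0"; cases "j = j0") (auto simp: verts_rook)
      moreover have "rook_laplacian n m (\<lambda>i j. of_bool ((i, j) \<in> {i0} \<times> {..<m})) i j
          = int n * of_bool (i = i0) - 1" if "i < n" "j < m" for i j
        using v that by (simp add: rook_laplacian_def sum_of_bool_eq algebra_simps)
      ultimately show ?goal
        using v by (intro unfire[of "{i0} \<times> {..<m}"]) (auto simp: verts_rook)
    next
      case column
      have "E (i0, j0) \<le> 2"
        using E_le[of "{(i0, j0), (i1, j0)}"] column v by (simp add: verts_rook)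
      then have "E (i, j) \<le> int m * of_bool (j = j0)" if "i < n" "j < m" for i j
        using others[of "(i, j)" "(i1, j0)"] other[of "(i, j)"] column v m that E0[of "(i, j)"]
        by (cases "i = i0"; cases "j = j0") (auto simp: verts_rook)
      moreover have "rook_laplacian n m (\<lambda>i j. of_bool ((i, j) \<in> {..<n} \<times> {j0})) i j
          = int m * of_bool (j = j0) - 1" if "i < n" "j < m" for i j
        using v that by (simp add: rook_laplacian_def sum_of_bool_eq algebra_simps)
      ultimately show ?goal
        using v by (intro unfire[of "{..<n} \<times> {j0}"]) (auto simp: verts_rook)
    next
      case vertex
      \<comment> \<open>The vertex gains \<open>n + m - 2\<close> chips and ends with at least 3
        before \<open>E\<close> is removed; its neighbours give up their single chip and owe
        nothing.\<close>
      have lap: "rook_laplacian n m (\<lambda>i j. of_bool ((i, j) \<in> {(i0, j0)})) i j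
          = int (n + m) * of_bool (i = i0 \<and> j = j0) - of_bool (i = i0) - of_bool (j = j0)"
        if "i < n" "j < m" for i j
        using v that by (cases "i = i0"; cases "j = j0") (simp_all add: rook_laplacian_def sum_of_bool_eq)
      have "E (i, j) \<le> 1 + (int (n + m) * of_bool (i = i0 \<and> j = j0) - of_bool (i = i0) - of_bool (j = j0))"
        if "i < n" "j < m" for i j
        using vertex that other[of "(i, j)"] E3 n m
        by (cases "i = i0"; cases "j = j0") (auto simp: verts_rook)
      then show ?goal
        using v lap by (intro unfire[of "{(i0, j0)}"]) (auto simp: verts_rook)
    qed
  qed
qed

section \<open>The two gonalities\<close>

text \<open>A \<open>LEAST\<close> over the integers need not be attained; here a lower bound that
  is attained determines it.\<close>

lemma gon_eqI:
  assumes "D \<in> divisors G" "deg G D = d" "rank_at_least G k D"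
    and "\<And>D. D \<in> divisors G \<Longrightarrow> rank_at_least G k D \<Longrightarrow> d \<le> deg G D"
  shows "gon k G = d"
  unfolding gon_def using assms by (intro Least_equality) auto

theorem theorem1p4:
  fixes n m :: nat
  assumes "n \<ge> 2" and "m \<ge> 2"
  shows "gon 2 (complete_graph n \<box> complete_graph m) = int (n * m) - 1
       \<and> gon 3 (complete_graph n \<box> complete_graph m) = int (n * m)"
proof
  interpret connected_multigraph "rook n m"
    using assms by (intro connected_multigraph_rook) auto
  have v: "(0, 0) \<in> verts (rook n m)" using assms by (simp add: verts_rook)
  let ?D = "\<lambda>w. all_ones n m w - of_bool (w = (0, 0))"
  have lower: "int (n * m) - 1 \<le> deg (rook n m) D" if "rank_at_least (rook n m) 2 D" for D
    using assms that by (intro degree_ge_of_rank_2) auto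
  \<comment> \<open>Serves twice: for the rank of \<open>?D\<close>, and to deduce the lower bound
    for \<open>gon 3\<close> from the one for \<open>gon 2\<close>.\<close>
  have remove: "rank_at_least (rook n m) 2 (\<lambda>w. D w - of_bool (w = (0, 0)))"
    if "rank_at_least (rook n m) 3 D" for D
    using rank_at_least_remove_chip[of 2 D "(0, 0)"] that v by (simp add: eval_nat_numeral)
  show "gon 2 (rook n m) = int (n * m) - 1"
  proof (rule gon_eqI)
    show "?D \<in> divisors (rook n m)"
      using v by (auto simp: divisors_def all_ones_def verts_rook)
    show "deg (rook n m) ?D = int (n * m) - 1"
      using v by (simp only: deg_diff deg_all_ones deg_of_bool)
    show "rank_at_least (rook n m) 2 ?D"
      using assms by (intro remove rank_all_ones)
  qed (rule lower)
  show "gon 3 (rook n m) = int (n * m)"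
  proof (rule gon_eqI[OF all_ones_divisors deg_all_ones])
    show "rank_at_least (rook n m) 3 (all_ones n m)" using assms by (rule rank_all_ones)
    fix D assume "rank_at_least (rook n m) 3 D"
    then show "int (n * m) \<le> deg (rook n m) D"
      using lower[OF remove, of D] v by (simp add: deg_diff deg_of_bool)
  qed
qed

end
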